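(* Let $G$ be a finite group and $S$ a generating set of $G$. If the Cayley digraph $Cay(G,S)$ is a line digraph (i.e. isomorphic to $L(D)$ for some digraph $D$), then $Cay(G,S)$ is the pattern of a unitary matrix: there exists a unitary complex matrix $U$ with rows and columns indexed by $G$ such that for all $g,h\in G$, $(g,h)$ is an arc of $Cay(G,S)$ if and only if $U_{gh}\neq 0$.
   Context: The (right) Cayley digraph $Cay(G,S)$ of a finite group $G=\langle S\rangle$ has vertex set $G$ and arc set $\{(g,gs): g\in G, s\in S\}$ (loops allowed). For a digraph $D=(V,A)$ with $A\subseteq V\times V$, the line digraph $L(D)$ has vertex set $A(D)$, with $((u,v),(w,z))$ an arc if and only if $v=w$. A digraph on $n$ vertices is the pattern of an $n\times n$ matrix $M$ if $(u,v)$ is an arc exactly when $M_{uv}\neq 0$. A complex square matrix $U$ is unitary if $U^\dagger U=I$.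
   Formalization: The generating set S is assumed nonempty; this excludes only the trivial group with S empty, where Cay(G,S) is one loopless vertex (a line digraph) but the 1×1 zero matrix is not unitary. *)

theory Defs
  imports
    Complex_Main
    "HOL-Algebra.Generated_Groups"
    "Graph_Theory.Digraph_Isomorphism"
    "Graph_Theory.Pair_Digraph"
begin

definition cayley_digraph :: "('a, 'm) monoid_scheme \<Rightarrow> 'a set \<Rightarrow> 'a pair_pre_digraph" where
  "cayley_digraph G S =
    \<lparr> pverts = carrier G, parcs = {(g, g \<otimes>\<^bsub>G\<^esub> s) | g s. g \<in> carrier G \<and> s \<in> S} \<rparr>"

definition line_digraph :: "'v pair_pre_digraph \<Rightarrow> ('v \<times> 'v) pair_pre_digraph" where
  "line_digraph D =
    \<lparr> pverts = parcs D,
      parcs = {((u, v), (w, z)) | u v w z. (u, v) \<in> parcs D \<and> (w, z) \<in> parcs D \<and> v = w} \<rparr>"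

text \<open>Square matrices with rows and columns indexed by a finite set \<open>I\<close> are functions
  \<open>'i \<Rightarrow> 'i \<Rightarrow> complex\<close> of which only the entries with both indices in \<open>I\<close> matter.\<close>

definition matrix_mult_on ::
    "'i set \<Rightarrow> ('i \<Rightarrow> 'i \<Rightarrow> complex) \<Rightarrow> ('i \<Rightarrow> 'i \<Rightarrow> complex) \<Rightarrow> 'i \<Rightarrow> 'i \<Rightarrow> complex" where
  "matrix_mult_on I A B i j = (\<Sum>k\<in>I. A i k * B k j)"

definition conj_transpose :: "('i \<Rightarrow> 'i \<Rightarrow> complex) \<Rightarrow> 'i \<Rightarrow> 'i \<Rightarrow> complex" where
  "conj_transpose A i j = cnj (A j i)"

definition unitary_matrix_on :: "'i set \<Rightarrow> ('i \<Rightarrow> 'i \<Rightarrow> complex) \<Rightarrow> bool" where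
  "unitary_matrix_on I U \<longleftrightarrow>
    finite I \<and>
    (\<forall>i\<in>I. \<forall>j\<in>I. matrix_mult_on I (conj_transpose U) U i j = (if i = j then 1 else 0))"

definition pattern_of :: "'v pair_pre_digraph \<Rightarrow> ('v \<Rightarrow> 'v \<Rightarrow> complex) \<Rightarrow> bool" where
  "pattern_of D M \<longleftrightarrow>
    (\<forall>u\<in>pverts D. \<forall>v\<in>pverts D. (u, v) \<in> parcs D \<longleftrightarrow> M u v \<noteq> 0)"

end

theory Submission
  imports Defs
begin

text \<open>In a line digraph the out-neighbourhoods of two vertices are equal or disjoint. For
  \<open>Cay(G,S)\<close> this makes the adjacency matrix \<open>A\<close> a disjoint union of all-ones blocks of size
  \<open>k \<times> k\<close> with \<open>k = |S|\<close>. Fix \<open>s \<in> S\<close> and let \<open>P\<close> be the permutation matrix of right multiplication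
  by \<open>s\<close>, whose entries lie inside the blocks. For \<open>c = (\<i> - 1) / k\<close> the matrix \<open>P + c A\<close> is
  unitary, since \<open>k |c|\<^sup>2 + 2 Re c = 0\<close>, and all its entries in the blocks, \<open>c\<close> or \<open>1 + c\<close>, are
  nonzero.\<close>

text \<open>Heuchenne's condition, which characterises line digraphs; only its necessity matters here.\<close>

definition heuchenne :: "'v pair_pre_digraph \<Rightarrow> bool" where
  "heuchenne D \<longleftrightarrow>
    (\<forall>x y z w. (x, z) \<in> parcs D \<longrightarrow> (y, z) \<in> parcs D \<longrightarrow> (y, w) \<in> parcs D \<longrightarrow> (x, w) \<in> parcs D)"

text \<open>Arcs of \<open>line_digraph D\<close> are equalities between a second component and a
  first component; three of them chain to the fourth.\<close>

lemma heuchenne_line_digraph: "heuchenne (line_digraph D)"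
  unfolding heuchenne_def line_digraph_def by auto

text \<open>\<open>digraph_iso\<close> carries separate maps for vertices, arcs, tails and heads.
  Under \<open>with_proj\<close> tail and head are \<open>fst\<close> and \<open>snd\<close> on both
  sides, so the vertex map determines the arc map and suffices alone.\<close>

lemma digraph_iso_with_projE:
  assumes "digraph_iso (with_proj C) (with_proj D)"
  obtains f where "inj_on f (pverts C)"
    and "\<And>u v. u \<in> pverts C \<Longrightarrow> v \<in> pverts C \<Longrightarrow> (u, v) \<in> parcs C \<longleftrightarrow> (f u, f v) \<in> parcs D"
    and "parcs C \<subseteq> pverts C \<times> pverts C"
proof -
  from assms obtain h where iso: "pre_digraph.digraph_isomorphism (with_proj C) h"
    and D: "with_proj D = app_iso h (with_proj C)"
    unfolding digraph_iso_def by blast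
  note iso = iso[unfolded pre_digraph.digraph_isomorphism_def, simplified]
  have sub: "parcs C \<subseteq> pverts C \<times> pverts C"
    using iso wf_digraph.tail_in_verts[of "with_proj C"] wf_digraph.head_in_verts[of "with_proj C"]
    by fastforce
  have inj: "inj_on (iso_verts h) (pverts C)"
    using iso by blast
  have arcs: "parcs D = iso_arcs h ` parcs C"
    and tl: "fst = iso_tail h" and hd: "snd = iso_head h"
    using arg_cong[OF D, of arcs] arg_cong[OF D, of tail] arg_cong[OF D, of head]
    by (simp_all add: app_iso_def)
  have map: "iso_arcs h (u, v) = (iso_verts h u, iso_verts h v)" if "(u, v) \<in> parcs C" for u v
    using iso that unfolding tl[symmetric] hd[symmetric] by (auto intro: prod_eqI)
  have "(u, v) \<in> parcs C \<longleftrightarrow> (iso_verts h u, iso_verts h v) \<in> parcs D"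
    if "u \<in> pverts C" "v \<in> pverts C" for u v
  proof
    assume "(u, v) \<in> parcs C"
    then show "(iso_verts h u, iso_verts h v) \<in> parcs D"
      using map arcs by (metis imageI)
  next
    assume "(iso_verts h u, iso_verts h v) \<in> parcs D"
    then obtain u' v' where e: "(u', v') \<in> parcs C"
      and "(iso_verts h u, iso_verts h v) = iso_arcs h (u', v')"
      unfolding arcs by auto
    then have "iso_verts h u = iso_verts h u'" "iso_verts h v = iso_verts h v'"
      using map by auto
    then have "u = u'" "v = v'"
      using inj that e sub by (auto dest: inj_onD)
    then show "(u, v) \<in> parcs C"
      using e by simp
  qed
  with inj sub that show thesis by blast
qed

lemma heuchenne_digraph_iso:
  assumes "digraph_iso (with_proj C) (with_proj D)" "heuchenne D"
  shows "heuchenne C"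
proof -
  obtain f where f: "\<And>u v. u \<in> pverts C \<Longrightarrow> v \<in> pverts C \<Longrightarrow> (u, v) \<in> parcs C \<longleftrightarrow> (f u, f v) \<in> parcs D"
    and sub: "parcs C \<subseteq> pverts C \<times> pverts C"
    using digraph_iso_with_projE[OF assms(1)] by metis
  show ?thesis
    unfolding heuchenne_def
  proof (intro allI impI)
    fix x y z w
    assume a: "(x, z) \<in> parcs C" "(y, z) \<in> parcs C" "(y, w) \<in> parcs C"
    then have v: "x \<in> pverts C" "y \<in> pverts C" "z \<in> pverts C" "w \<in> pverts C"
      using sub by auto
    then have "(f x, f z) \<in> parcs D" "(f y, f z) \<in> parcs D" "(f y, f w) \<in> parcs D"
      using a f by auto
    with assms(2) have "(f x, f w) \<in> parcs D"
      unfolding heuchenne_def by blast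
    then show "(x, w) \<in> parcs C"
      using f v by simp
  qed
qed

text \<open>The map sending \<open>s\<close> to h s^-1 is a bijection from \<open>S\<close> onto the
  in-neighbours of \<open>h\<close>. This gives the number of nonzero entries in each column of the
  adjacency matrix.\<close>

lemma card_in_neighbours_cayley_digraph:
  assumes "group G" "S \<subseteq> carrier G" "h \<in> carrier G"
  shows "card {g. (g, h) \<in> parcs (cayley_digraph G S)} = card S"
proof -
  interpret group G by fact
  have "{g. (g, h) \<in> parcs (cayley_digraph G S)} = (\<lambda>s. h \<otimes>\<^bsub>G\<^esub> inv\<^bsub>G\<^esub> s) ` S"
  proof (intro equalityI subsetI)
    fix g assume "g \<in> {g. (g, h) \<in> parcs (cayley_digraph G S)}"
    then obtain s where "g \<in> carrier G" "s \<in> S" "h = g \<otimes>\<^bsub>G\<^esub> s"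
      unfolding cayley_digraph_def by auto
    moreover from this have "h \<otimes>\<^bsub>G\<^esub> inv\<^bsub>G\<^esub> s = g"
      using assms by (auto simp: m_assoc subset_iff)
    ultimately show "g \<in> (\<lambda>s. h \<otimes>\<^bsub>G\<^esub> inv\<^bsub>G\<^esub> s) ` S"
      by (metis imageI)
  next
    fix g assume "g \<in> (\<lambda>s. h \<otimes>\<^bsub>G\<^esub> inv\<^bsub>G\<^esub> s) ` S"
    then obtain s where s: "s \<in> S" "s \<in> carrier G" "g = h \<otimes>\<^bsub>G\<^esub> inv\<^bsub>G\<^esub> s"
      using assms by auto
    then have "h = g \<otimes>\<^bsub>G\<^esub> s" "g \<in> carrier G"
      using assms by (auto simp: m_assoc)
    then show "g \<in> {g. (g, h) \<in> parcs (cayley_digraph G S)}"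
      using s unfolding cayley_digraph_def by auto
  qed
  moreover have "inj_on (\<lambda>s. h \<otimes>\<^bsub>G\<^esub> inv\<^bsub>G\<^esub> s) S"
    using assms by (intro inj_onI) (metis inv_closed inv_inv Units_eq Units_l_cancel subsetD)
  ultimately show ?thesis by (simp add: card_image)
qed

lemma unitary_pattern_cayley_digraph:
  assumes "group G" "finite (carrier G)" "S \<subseteq> carrier G" "S \<noteq> {}"
    and "heuchenne (cayley_digraph G S)"
  shows "\<exists>U :: 'a \<Rightarrow> 'a \<Rightarrow> complex.
    unitary_matrix_on (carrier G) U \<and> pattern_of (cayley_digraph (G :: ('a, 'm) monoid_scheme) S) U"
proof -
  interpret group G by fact
  let ?E = "parcs (cayley_digraph G S)"
  obtain s where s: "s \<in> S" "s \<in> carrier G"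
    using assms by auto
  define k where "k = card S"
  have k: "k > 0"
    using assms unfolding k_def by (meson card_gt_0_iff finite_subset)
  \<comment> \<open>With this choice 1 + k c = \<i> has modulus 1, which is \<open>cc\<close> up to
    the factor \<open>k\<close>. The real solution -2/k would give 1 + c = 0 for k = 2; here
    \<open>c\<close> and 1 + c have imaginary part 1/k and never vanish.\<close>
  define c :: complex where "c = (\<i> - 1) / of_nat k"
  have c0: "c \<noteq> 0" "1 + c \<noteq> 0"
    using k by (auto simp: c_def complex_eq_iff Im_divide_of_nat)
  have cc: "of_nat k * (cnj c * c) + cnj c + c = 0"
    using k by (simp add: c_def field_simps)
  define A :: "'a \<Rightarrow> 'a \<Rightarrow> complex" where "A g h = of_bool ((g, h) \<in> ?E)" for g h
  define P :: "'a \<Rightarrow> 'a \<Rightarrow> complex" where "P g h = of_bool (h = g \<otimes>\<^bsub>G\<^esub> s)" for g h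
  define U where "U g h = P g h + c * A g h" for g h
  have arc_s: "(g, g \<otimes>\<^bsub>G\<^esub> s) \<in> ?E" if "g \<in> carrier G" for g
    using that s unfolding cayley_digraph_def by auto
  have carr: "g \<in> carrier G" if "(g, h) \<in> ?E" for g h
    using that unfolding cayley_digraph_def by auto
  have P_eq: "P g h = of_bool (g = h \<otimes>\<^bsub>G\<^esub> inv\<^bsub>G\<^esub> s)" if "g \<in> carrier G" "h \<in> carrier G" for g h
    using that s unfolding P_def by (auto simp: m_assoc)
  \<comment> \<open>Column \<open>h\<close> of \<open>P\<close> has its only 1 in row h s^-1, so the
    sum picks out a single value of \<open>F\<close>.\<close>
  have sumP: "(\<Sum>g\<in>carrier G. P g h * F g) = F (h \<otimes>\<^bsub>G\<^esub> inv\<^bsub>G\<^esub> s)" if "h \<in> carrier G" for h F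
  proof -
    have "(\<Sum>g\<in>carrier G. P g h * F g) = (\<Sum>g\<in>carrier G. if g = h \<otimes>\<^bsub>G\<^esub> inv\<^bsub>G\<^esub> s then F g else 0)"
      using that by (intro sum.cong) (auto simp: P_eq)
    then show ?thesis
      using that s assms(2) by simp
  qed
  have "matrix_mult_on (carrier G) (conj_transpose U) U i j = (if i = j then 1 else 0)"
    if ij: "i \<in> carrier G" "j \<in> carrier G" for i j
  proof -
    \<comment> \<open>The rows in which columns \<open>i\<close> and \<open>j\<close> of
      \<open>P\<close> have their 1. As in-neighbours of \<open>i\<close> and \<open>j\<close> they
      also serve as representatives of the blocks.\<close>
    define i' where "i' = i \<otimes>\<^bsub>G\<^esub> inv\<^bsub>G\<^esub> s"
    define j' where "j' = j \<otimes>\<^bsub>G\<^esub> inv\<^bsub>G\<^esub> s"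
    have i': "i' \<in> carrier G" "(i', i) \<in> ?E" and j': "j' \<in> carrier G" "(j', j) \<in> ?E"
      using ij s arc_s[of i'] arc_s[of j'] by (auto simp: i'_def j'_def m_assoc)
    have swap: "(x, j) \<in> ?E" if "(x, i) \<in> ?E" "(y, i) \<in> ?E" "(y, j) \<in> ?E" for x y i j
      using assms(5) that unfolding heuchenne_def by blast
    have sym: "(j', i) \<in> ?E \<longleftrightarrow> (i', j) \<in> ?E"
      using swap i' j' by blast
    \<comment> \<open>This counts the common in-neighbours of \<open>i\<close> and \<open>j\<close>.
      If \<open>i'\<close> has an arc to \<open>j\<close>, then so has every in-neighbour of
      \<open>i\<close>, which makes \<open>k\<close> of them; otherwise there are none.\<close>
    have AA: "(\<Sum>g\<in>carrier G. A g i * A g j) = of_nat k * A i' j"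
    proof -
      have "(\<Sum>g\<in>carrier G. A g i * A g j)
          = (\<Sum>g\<in>carrier G. of_bool (g \<in> {g. (g, i) \<in> ?E \<and> (g, j) \<in> ?E}))"
        by (intro sum.cong) (auto simp: A_def)
      also have "\<dots> = of_nat (card (carrier G \<inter> {g. (g, i) \<in> ?E \<and> (g, j) \<in> ?E}))"
        using assms(2) by (simp add: of_bool_def sum.If_cases)
      also have "carrier G \<inter> {g. (g, i) \<in> ?E \<and> (g, j) \<in> ?E}
          = (if (i', j) \<in> ?E then {g. (g, i) \<in> ?E} else {})"
      proof (cases "(i', j) \<in> ?E")
        case True
        then have "(g, j) \<in> ?E" if "(g, i) \<in> ?E" for g
          using swap[OF that i'(2)] by simp
        then show ?thesis
          using True carr by auto
      next
        case False
        then have "\<not> ((g, i) \<in> ?E \<and> (g, j) \<in> ?E)" for g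
          using swap[OF i'(2)] by blast
        then show ?thesis
          using False by auto
      qed
      also have "of_nat (card \<dots>) = of_nat k * A i' j"
        using card_in_neighbours_cayley_digraph[OF assms(1,3) ij(1)] by (simp add: A_def k_def)
      finally show ?thesis .
    qed
    have Aji: "A j' i = A i' j"
      using sym by (simp add: A_def)
    have real: "cnj (P g h) = P g h" "cnj (A g h) = A g h" for g h
      by (simp_all add: P_def A_def)
    have "matrix_mult_on (carrier G) (conj_transpose U) U i j
        = (\<Sum>g\<in>carrier G. P g i * P g j + c * (P g i * A g j) + cnj c * (P g j * A g i)
            + cnj c * c * (A g i * A g j))"
      unfolding matrix_mult_on_def conj_transpose_def U_def
      by (intro sum.cong) (simp_all add: real algebra_simps)
    also have "\<dots> = P i' j + c * A i' j + cnj c * A j' i + cnj c * c * (of_nat k * A i' j)"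
      by (simp only: sum.distrib sum_distrib_left[symmetric] sumP[OF ij(1)] sumP[OF ij(2)] AA
          i'_def[symmetric] j'_def[symmetric])
    \<comment> \<open>By \<open>Aji\<close> all terms with \<open>A\<close> are multiples of the one
      entry \<open>A i' j\<close>, and \<open>cc\<close> says that their coefficients cancel. Since
      i' s = i, the remaining \<open>P i' j\<close> is the identity entry.\<close>
    also have "\<dots> = P i' j + (of_nat k * (cnj c * c) + cnj c + c) * A i' j"
      by (simp add: Aji algebra_simps)
    also have "\<dots> = (if i = j then 1 else 0)"
      using ij s unfolding cc by (auto simp: P_def i'_def m_assoc)
    finally show ?thesis .
  qed
  then have "unitary_matrix_on (carrier G) U"
    using assms(2) unfolding unitary_matrix_on_def by blast
  moreover have "pattern_of (cayley_digraph G S) U"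
    unfolding pattern_of_def
  proof (intro ballI)
    fix g h assume "g \<in> pverts (cayley_digraph G S)"
    then have "g \<in> carrier G"
      by (simp add: cayley_digraph_def)
    \<comment> \<open>On an arc the entry is \<open>c\<close> or 1 + c. Off the arcs
      \<open>P\<close> vanishes along with \<open>A\<close>, because \<open>g\<close> always has an
      arc to g s.\<close>
    then show "(g, h) \<in> ?E \<longleftrightarrow> U g h \<noteq> 0"
      using c0 arc_s by (auto simp: U_def P_def A_def)
  qed
  ultimately show ?thesis by blast
qed

theorem theorem2p2:
  fixes G :: "('a, 'm) monoid_scheme"
    and S :: "'a set"
    and D :: "'v pair_pre_digraph"
  assumes "group G"
    and "finite (carrier G)"
    and "S \<subseteq> carrier G"
    and "S \<noteq> {}"
    and "generate G S = carrier G"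
    and "pair_wf_digraph D"
    and "digraph_iso (with_proj (cayley_digraph G S)) (with_proj (line_digraph D))"
  shows "\<exists>U :: 'a \<Rightarrow> 'a \<Rightarrow> complex.
    unitary_matrix_on (carrier G) U \<and> pattern_of (cayley_digraph G S) U"
  using unitary_pattern_cayley_digraph[OF assms(1-4)]
    heuchenne_digraph_iso[OF assms(7) heuchenne_line_digraph] by blast

end
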